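(* Let $F$ be a field, $L$ a separable field extension of $F$, $\sigma\in\mathrm{Aut}(L/F)$ a nontrivial automorphism, and $\eta,\mu\in L$ with $\eta\neq0$. Let $A=HK(L,\sigma,\eta,\mu)$. All automorphisms of $A$ are of the form $$(x,y)\mapsto(\tau(x),\tau(y)b),$$ where $\tau\in\mathrm{Aut}(L/F)$ commutes with $\sigma$ and $b\in L^\times$ is such that $$\eta\,b\,\sigma(b)=\tau(\eta)\quad\text{and}\quad\mu\,\sigma(b)=\tau(\mu).$$
   Context: $HK(L,\sigma,\eta,\mu)$ is the $F$-vector space $L\oplus L$ with multiplication $(x,y)(u,v)=(xu+\eta\sigma(v)y,\ vx+y\sigma(u)+\mu\sigma(v)y)$ for $x,y,u,v\in L$. It is a unital $F$-algebra with unit $(1,0)$.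
   Formalization: The formal theorem additionally assumes that A is not associative (excluding the case σ²=id, μ=0, σ(η)=η); without this the claim fails, e.g. for Hamilton's quaternions HK(ℂ, conjugation, −1, 0) over ℝ. *)

theory Defs
  imports "HOL-Computational_Algebra.Polynomial" "HOL-Library.Product_Plus"
begin

text \<open>A field extension \<open>L/F\<close> is given by two field types and an embedding of \<open>F\<close> into \<open>L\<close>;
  such an embedding is automatically injective.\<close>

definition field_extension :: "('f::field \<Rightarrow> 'l::field) \<Rightarrow> bool" where
  "field_extension emb \<longleftrightarrow>
     emb 1 = 1 \<and> (\<forall>a b. emb (a + b) = emb a + emb b) \<and> (\<forall>a b. emb (a * b) = emb a * emb b)"

definition minimal_polynomial :: "('f::field \<Rightarrow> 'l::field) \<Rightarrow> 'l \<Rightarrow> 'f poly \<Rightarrow> bool" where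
  "minimal_polynomial emb x p \<longleftrightarrow>
     lead_coeff p = 1 \<and> irreducible p \<and> poly (map_poly emb p) x = 0"

definition separable_poly :: "'f::field poly \<Rightarrow> bool" where
  "separable_poly p \<longleftrightarrow> coprime p (pderiv p)"

text \<open>Separable extensions are algebraic: every element has a minimal polynomial over \<open>F\<close>.\<close>

definition separable_extension :: "('f::field \<Rightarrow> 'l::field) \<Rightarrow> bool" where
  "separable_extension emb \<longleftrightarrow>
     field_extension emb \<and> (\<forall>x. \<exists>p. minimal_polynomial emb x p \<and> separable_poly p)"

definition Aut_ext :: "('f::field \<Rightarrow> 'l::field) \<Rightarrow> ('l \<Rightarrow> 'l) set" where
  "Aut_ext emb = {\<tau>. bij \<tau> \<and> (\<forall>x y. \<tau> (x + y) = \<tau> x + \<tau> y) \<and>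
     (\<forall>x y. \<tau> (x * y) = \<tau> x * \<tau> y) \<and> (\<forall>c. \<tau> (emb c) = emb c)}"

definition HK_mult :: "('l::field \<Rightarrow> 'l) \<Rightarrow> 'l \<Rightarrow> 'l \<Rightarrow> 'l \<times> 'l \<Rightarrow> 'l \<times> 'l \<Rightarrow> 'l \<times> 'l" where
  "HK_mult \<sigma> \<eta> \<mu> = (\<lambda>(x, y) (u, v). (x * u + \<eta> * \<sigma> v * y, v * x + y * \<sigma> u + \<mu> * \<sigma> v * y))"

definition HK_scale :: "('f::field \<Rightarrow> 'l::field) \<Rightarrow> 'f \<Rightarrow> 'l \<times> 'l \<Rightarrow> 'l \<times> 'l" where
  "HK_scale emb c = (\<lambda>(x, y). (emb c * x, emb c * y))"

definition algebra_Aut ::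
  "('f::field \<Rightarrow> 'a::ab_group_add \<Rightarrow> 'a) \<Rightarrow> ('a \<Rightarrow> 'a \<Rightarrow> 'a) \<Rightarrow> ('a \<Rightarrow> 'a) set" where
  "algebra_Aut scale prd = {\<phi>. Vector_Spaces.linear scale scale \<phi> \<and> bij \<phi> \<and>
     (\<forall>a b. \<phi> (prd a b) = prd (\<phi> a) (\<phi> b))}"

abbreviation HK_Aut ::
  "('f::field \<Rightarrow> 'l::field) \<Rightarrow> ('l \<Rightarrow> 'l) \<Rightarrow> 'l \<Rightarrow> 'l \<Rightarrow> ('l \<times> 'l \<Rightarrow> 'l \<times> 'l) set" where
  "HK_Aut emb \<sigma> \<eta> \<mu> \<equiv> algebra_Aut (HK_scale emb) (HK_mult \<sigma> \<eta> \<mu>)"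

text \<open>\<open>HK(L,\<sigma>,\<eta>,\<mu>)\<close> is associative exactly when \<open>\<sigma>\<^sup>2 = id\<close>, \<open>\<mu> = 0\<close> and \<open>\<sigma> \<eta> = \<eta>\<close>.  It is then
  a quaternion algebra over the fixed field of \<open>\<sigma>\<close>, and its inner automorphisms need not preserve \<open>L\<close>:
  Hamilton's quaternions \<open>HK(\<complex>, cnj, -1, 0)\<close> have automorphisms that are not of the form
  \<open>(x, y) \<mapsto> (\<tau> x, \<tau> y * b)\<close>.  A description of all automorphisms in that form therefore needs
  the hypothesis that the algebra is not associative.\<close>

lemma vector_space_HK_scale:
  assumes "field_extension emb"
  shows "vector_space (HK_scale emb)"
  using assms by unfold_locales (auto simp: field_extension_def HK_scale_def algebra_simps)

end

theory Submission
  imports Defs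
begin

text \<open>The multiplication is \<open>L\<close>-linear in its left argument, so the left nucleus is an \<open>L\<close>-subspace
  of \<open>L \<oplus> L\<close> containing the line \<open>L \<oplus> 0\<close>. It is therefore either this line or the whole algebra,
  and the latter means associativity. In the nonassociative case every automorphism \<open>\<phi>\<close> hence
  preserves \<open>L \<oplus> 0\<close> and restricts there to some \<open>\<tau>\<close>. Since \<open>(x, y) = (x, 0) + (y, 0)(0, 1)\<close>, the
  map \<open>\<phi>\<close> is determined by \<open>\<tau>\<close> and \<open>\<phi> (0, 1) = (c, b)\<close>, and the relations
  \<open>(0, 1)(u, 0) = (0, \<sigma> u)\<close> and \<open>(0, 1)(0, 1) = (\<eta>, \<mu>)\<close> give all the remaining conditions.\<close>

definition left_nucleus :: "('a \<Rightarrow> 'a \<Rightarrow> 'a) \<Rightarrow> 'a set" where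
  "left_nucleus prd = {a. \<forall>b c. prd (prd a b) c = prd a (prd b c)}"

lemma semigroup_iff_left_nucleus: "semigroup prd \<longleftrightarrow> left_nucleus prd = UNIV"
  by (auto simp: semigroup_def left_nucleus_def)

text \<open>Surjectivity lets the two arguments in the target run over images under
  \<open>\<phi>\<close> only, and injectivity then cancels \<open>\<phi>\<close>.\<close>

lemma left_nucleus_hom_iff:
  assumes "bij \<phi>" and hom: "\<And>a b. \<phi> (prd a b) = prd' (\<phi> a) (\<phi> b)"
  shows "\<phi> a \<in> left_nucleus prd' \<longleftrightarrow> a \<in> left_nucleus prd"
proof -
  have "\<phi> a \<in> left_nucleus prd' \<longleftrightarrow>
      (\<forall>b c. prd' (prd' (\<phi> a) (\<phi> b)) (\<phi> c) = prd' (\<phi> a) (prd' (\<phi> b) (\<phi> c)))"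
    using bij_is_surj[OF \<open>bij \<phi>\<close>] unfolding left_nucleus_def mem_Collect_eq by (metis surjD)
  also have "\<dots> \<longleftrightarrow> (\<forall>b c. \<phi> (prd (prd a b) c) = \<phi> (prd a (prd b c)))"
    by (simp add: hom)
  also have "\<dots> \<longleftrightarrow> a \<in> left_nucleus prd"
    using bij_is_inj[OF \<open>bij \<phi>\<close>] by (simp add: left_nucleus_def inj_eq)
  finally show ?thesis .
qed

lemma HK_mult_Pair:
  "HK_mult \<sigma> \<eta> \<mu> (x, y) (u, v) = (x * u + \<eta> * \<sigma> v * y, v * x + y * \<sigma> u + \<mu> * \<sigma> v * y)"
  by (simp add: HK_mult_def)

text \<open>Only entries of the right factor are twisted by \<open>\<sigma>\<close>; those of the
  left factor enter linearly.\<close>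

lemma HK_mult_left_linear:
  "HK_mult \<sigma> \<eta> \<mu> (l * x + m * x', l * y + m * y') q =
     (l * fst (HK_mult \<sigma> \<eta> \<mu> (x, y) q) + m * fst (HK_mult \<sigma> \<eta> \<mu> (x', y') q),
      l * snd (HK_mult \<sigma> \<eta> \<mu> (x, y) q) + m * snd (HK_mult \<sigma> \<eta> \<mu> (x', y') q))"
  by (cases q) (simp add: HK_mult_Pair algebra_simps)

text \<open>For fixed b and c, both (ab)c and a(bc) arise from a by right multiplications, so both
  are \<open>L\<close>-linear in a.\<close>

lemma left_nucleus_HK_linear:
  assumes "(x, y) \<in> left_nucleus (HK_mult \<sigma> \<eta> \<mu>)" and "(x', y') \<in> left_nucleus (HK_mult \<sigma> \<eta> \<mu>)"
  shows "(l * x + m * x', l * y + m * y') \<in> left_nucleus (HK_mult \<sigma> \<eta> \<mu>)"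
  using assms by (simp add: left_nucleus_def HK_mult_left_linear)

lemma Aut_extD:
  assumes "\<tau> \<in> Aut_ext emb"
  shows "bij \<tau>" and "\<tau> (x + y) = \<tau> x + \<tau> y" and "\<tau> (x * y) = \<tau> x * \<tau> y" and "\<tau> (emb c) = emb c"
    and "\<tau> 0 = 0" and "\<tau> 1 = 1" and "\<tau> x = 0 \<longleftrightarrow> x = 0" and "\<tau> x = \<tau> y \<longleftrightarrow> x = y"
proof -
  note \<tau> = assms[unfolded Aut_ext_def, simplified]
  show "bij \<tau>" and "\<tau> (x + y) = \<tau> x + \<tau> y" and "\<tau> (x * y) = \<tau> x * \<tau> y" and "\<tau> (emb c) = emb c"
    using \<tau> by auto
  show inj: "\<tau> x = \<tau> y \<longleftrightarrow> x = y" for x y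
    using \<tau> by (simp add: bij_is_inj inj_eq)
  show z: "\<tau> 0 = 0"
    using \<tau> by (metis add_cancel_right_right)
  show "\<tau> x = 0 \<longleftrightarrow> x = 0"
    using inj[of x 0] z by simp
  show "\<tau> 1 = 1"
    using \<tau> inj[of 1 0] z by (metis mult_cancel_left mult_1_right zero_neq_one)
qed

text \<open>Left multiplication by \<open>(x, 0)\<close> scales both coordinates by
  \<open>x\<close>, and this commutes with the \<open>L\<close>-linear right
  multiplications.\<close>

lemma left_nucleus_HK_base:
  assumes "\<sigma> \<in> Aut_ext emb"
  shows "(x, 0) \<in> left_nucleus (HK_mult \<sigma> \<eta> \<mu>)"
  by (auto simp: left_nucleus_def HK_mult_Pair Aut_extD[OF assms] algebra_simps)

lemma left_nucleus_HK_mult: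
  assumes \<sigma>: "\<sigma> \<in> Aut_ext emb" and nonassoc: "\<not> semigroup (HK_mult \<sigma> \<eta> \<mu>)"
  shows "left_nucleus (HK_mult \<sigma> \<eta> \<mu>) = {p. snd p = 0}"
proof -
  let ?N = "left_nucleus (HK_mult \<sigma> \<eta> \<mu>)"
  have "b = 0" if ab: "(a, b) \<in> ?N" for a b
  proof (rule ccontr)
    assume "b \<noteq> 0"
    \<comment> \<open>Since \<open>b\<close> is invertible, \<open>(x, y)\<close> is
      \<open>y / b\<close> times \<open>(a, b)\<close> plus the base element
      \<open>(x - y / b * a, 0)\<close>.\<close>
    have "(x, y) \<in> ?N" for x y
      using left_nucleus_HK_linear[OF ab left_nucleus_HK_base[OF \<sigma>, of "x - y / b * a"], of "y / b" 1]
        \<open>b \<noteq> 0\<close> by simp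
    then have "?N = UNIV" by auto
    with nonassoc show False by (simp add: semigroup_iff_left_nucleus)
  qed
  then show ?thesis
    using left_nucleus_HK_base[OF \<sigma>] by auto
qed

lemma HK_Aut_sufficient:
  assumes "field_extension emb" and \<tau>: "\<tau> \<in> Aut_ext emb" and comm: "\<tau> \<circ> \<sigma> = \<sigma> \<circ> \<tau>"
    and \<sigma>: "\<sigma> \<in> Aut_ext emb" and "b \<noteq> 0"
    and \<eta>: "\<eta> * b * \<sigma> b = \<tau> \<eta>" and \<mu>: "\<mu> * \<sigma> b = \<tau> \<mu>"
  shows "(\<lambda>(x, y). (\<tau> x, \<tau> y * b)) \<in> HK_Aut emb \<sigma> \<eta> \<mu>"
proof -
  let ?\<phi> = "\<lambda>(x, y). (\<tau> x, \<tau> y * b)"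
  interpret vector_space "HK_scale emb"
    using assms(1) by (rule vector_space_HK_scale)
  have comm': "\<tau> (\<sigma> x) = \<sigma> (\<tau> x)" for x
    using comm by (metis comp_apply)
  have "Vector_Spaces.linear (HK_scale emb) (HK_scale emb) ?\<phi>"
    by unfold_locales (auto simp: HK_scale_def Aut_extD[OF \<tau>] algebra_simps)
  moreover have "bij ?\<phi>"
  proof (rule bijI)
    show "inj ?\<phi>"
      using \<open>b \<noteq> 0\<close> by (auto simp: inj_on_def Aut_extD[OF \<tau>])
    have "\<tau> (inv \<tau> x) = x" for x
      using Aut_extD(1)[OF \<tau>] by (simp add: bij_is_surj surj_f_inv_f)
    then show "surj ?\<phi>"
      using \<open>b \<noteq> 0\<close> by (intro surjI[of _ "\<lambda>(x, y). (inv \<tau> x, inv \<tau> (y / b))"]) auto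
  qed
  \<comment> \<open>Moving \<open>\<tau>\<close> past \<open>\<sigma>\<close> and replacing
    \<open>\<tau> \<eta>\<close> and \<open>\<tau> \<mu>\<close> by their expressions in
    \<open>b\<close> leaves an identity of commutative rings.\<close>
  moreover have "?\<phi> (HK_mult \<sigma> \<eta> \<mu> p q) = HK_mult \<sigma> \<eta> \<mu> (?\<phi> p) (?\<phi> q)" for p q
    by (cases p; cases q)
      (simp add: HK_mult_Pair Aut_extD[OF \<tau>] Aut_extD[OF \<sigma>] comm' flip: \<eta> \<mu>; simp add: algebra_simps)
  ultimately show ?thesis
    by (simp add: algebra_Aut_def)
qed

lemma HK_Aut_necessary:
  assumes \<sigma>: "\<sigma> \<in> Aut_ext emb" and "\<sigma> \<noteq> id"
    and nonassoc: "\<not> semigroup (HK_mult \<sigma> \<eta> \<mu>)"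
    and \<phi>: "\<phi> \<in> HK_Aut emb \<sigma> \<eta> \<mu>"
  obtains \<tau> b where "\<tau> \<in> Aut_ext emb" and "\<tau> \<circ> \<sigma> = \<sigma> \<circ> \<tau>" and "b \<noteq> 0"
    and "\<eta> * b * \<sigma> b = \<tau> \<eta>" and "\<mu> * \<sigma> b = \<tau> \<mu>" and "\<phi> = (\<lambda>(x, y). (\<tau> x, \<tau> y * b))"
proof -
  let ?m = "HK_mult \<sigma> \<eta> \<mu>"
  have bij: "bij \<phi>" and hom: "\<And>p q. \<phi> (?m p q) = ?m (\<phi> p) (\<phi> q)"
    and lin: "Vector_Spaces.linear (HK_scale emb) (HK_scale emb) \<phi>"
    using \<phi> by (auto simp: algebra_Aut_def)
  interpret \<phi>: Vector_Spaces.linear "HK_scale emb" "HK_scale emb" \<phi>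
    by (rule lin)
  \<comment> \<open>Both directions matter: one makes \<open>\<phi>\<close> map L \<oplus> 0 into
    itself, the other yields \<open>b \<noteq> 0\<close> and the surjectivity of
    \<open>\<tau>\<close>.\<close>
  have nuc: "snd (\<phi> p) = 0 \<longleftrightarrow> snd p = 0" for p
    using left_nucleus_hom_iff[of \<phi> ?m ?m p, OF bij hom] by (simp add: left_nucleus_HK_mult[OF \<sigma> nonassoc])
  define \<tau> where "\<tau> x = fst (\<phi> (x, 0))" for x
  obtain c b where cb: "\<phi> (0, 1) = (c, b)" by fastforce
  have "b \<noteq> 0"
    using nuc[of "(0, 1)"] cb by simp
  have \<phi>_base: "\<phi> (x, 0) = (\<tau> x, 0)" for x
    using nuc[of "(x, 0)"] by (simp add: \<tau>_def prod_eq_iff)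
  have \<tau>_add: "\<tau> (x + y) = \<tau> x + \<tau> y" for x y
    using \<phi>.add[of "(x, 0)" "(y, 0)"] by (simp add: \<phi>_base)
  have \<tau>_mult: "\<tau> (x * y) = \<tau> x * \<tau> y" for x y
    using hom[of "(x, 0)" "(y, 0)"] by (simp add: \<phi>_base HK_mult_Pair Aut_extD[OF \<sigma>])
  have inj: "inj \<tau>"
    using bij_is_inj[OF bij] by (metis \<phi>_base injI inj_eq prod.inject)
  have surj: "surj \<tau>"
  proof (rule surjI)
    fix x
    have "\<phi> (inv \<phi> (x, 0)) = (x, 0)"
      using bij by (simp add: bij_is_surj surj_f_inv_f)
    moreover from this have "inv \<phi> (x, 0) = (fst (inv \<phi> (x, 0)), 0)"
      using nuc[of "inv \<phi> (x, 0)"] by (simp add: prod_eq_iff)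
    ultimately show "\<tau> (fst (inv \<phi> (x, 0))) = x"
      by (metis \<tau>_def fst_conv)
  qed
  have \<tau>_0: "\<tau> 0 = 0"
    using \<tau>_add[of 0 0] by (metis add_cancel_right_right)
  \<comment> \<open>\<open>\<tau> 1\<close> is idempotent, and it is nonzero by injectivity.\<close>
  have \<tau>_1: "\<tau> 1 = 1"
    using \<tau>_mult[of 1 1] inj_eq[OF inj, of 1 0] \<tau>_0 by simp
  have "\<tau> (emb d) = emb d" for d
    using \<phi>.scale[of d "(1, 0)"] by (simp add: \<phi>_base HK_scale_def \<tau>_1)
  then have \<tau>: "\<tau> \<in> Aut_ext emb"
    using inj surj \<tau>_add \<tau>_mult by (simp add: Aut_ext_def bij_def)
  have \<phi>_eq: "\<phi> (x, y) = (\<tau> x + \<tau> y * c, \<tau> y * b)" for x y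
  proof -
    have "\<phi> (x, y) = \<phi> ((x, 0) + ?m (y, 0) (0, 1))"
      by (simp add: HK_mult_Pair Aut_extD[OF \<sigma>])
    also have "\<dots> = (\<tau> x, 0) + ?m (\<tau> y, 0) (c, b)"
      by (simp add: \<phi>.add hom \<phi>_base cb)
    finally show ?thesis
      by (simp add: HK_mult_Pair mult.commute)
  qed
  \<comment> \<open>Comparing coordinates of the image of (0, 1)(u, 0) gives the first equation
    directly and the second after cancelling \<open>b\<close>.\<close>
  have rel: "\<tau> (\<sigma> u) * c = c * \<tau> u" "\<tau> (\<sigma> u) = \<sigma> (\<tau> u)" for u
    using hom[of "(0, 1)" "(u, 0)"] \<open>b \<noteq> 0\<close>
    by (auto simp: \<phi>_eq HK_mult_Pair Aut_extD[OF \<sigma>] \<tau>_0 \<tau>_1)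
  \<comment> \<open>An element moved by \<open>\<sigma>\<close> rules out
    \<open>c \<noteq> 0\<close>: cancelling \<open>c\<close> would give
    \<open>\<tau> (\<sigma> u) = \<tau> u\<close>, against injectivity of
    \<open>\<tau>\<close>.\<close>
  obtain u where "\<sigma> u \<noteq> u"
    using \<open>\<sigma> \<noteq> id\<close> by fastforce
  with rel(1)[of u] have "c = 0"
    by (simp add: Aut_extD[OF \<tau>] mult.commute)
  \<comment> \<open>With \<open>c = 0\<close>, squaring (0, 1) and applying \<open>\<phi>\<close>
    gives the first condition in the first coordinate; the second coordinate gives the other one
    times \<open>b\<close>.\<close>
  have "\<eta> * b * \<sigma> b = \<tau> \<eta>" and "\<mu> * \<sigma> b = \<tau> \<mu>"
    using hom[of "(0, 1)" "(0, 1)"] \<open>b \<noteq> 0\<close> \<open>c = 0\<close>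
    by (auto simp: \<phi>_eq HK_mult_Pair Aut_extD[OF \<sigma>] \<tau>_0 \<tau>_1 mult_ac)
  moreover have "\<tau> \<circ> \<sigma> = \<sigma> \<circ> \<tau>"
    using rel(2) by (simp add: fun_eq_iff)
  moreover have "\<phi> = (\<lambda>(x, y). (\<tau> x, \<tau> y * b))"
    using \<phi>_eq \<open>c = 0\<close> by (simp add: fun_eq_iff)
  ultimately show thesis
    using that[OF \<tau>] \<open>b \<noteq> 0\<close> by blast
qed

theorem proposition6p1:
  fixes emb :: "'f::field \<Rightarrow> 'l::field"
    and \<sigma> :: "'l \<Rightarrow> 'l" and \<eta> \<mu> :: 'l
    and \<phi> :: "'l \<times> 'l \<Rightarrow> 'l \<times> 'l"
  assumes "separable_extension emb"
    and "\<sigma> \<in> Aut_ext emb" and "\<sigma> \<noteq> id"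
    and "\<eta> \<noteq> 0"
    and "\<not> semigroup (HK_mult \<sigma> \<eta> \<mu>)" \<comment> \<open>\<open>HK(L,\<sigma>,\<eta>,\<mu>)\<close> is not associative\<close>
  shows "\<phi> \<in> HK_Aut emb \<sigma> \<eta> \<mu> \<longleftrightarrow>
    (\<exists>\<tau> b. \<tau> \<in> Aut_ext emb \<and> \<tau> \<circ> \<sigma> = \<sigma> \<circ> \<tau> \<and> b \<noteq> 0 \<and>
       \<eta> * b * \<sigma> b = \<tau> \<eta> \<and> \<mu> * \<sigma> b = \<tau> \<mu> \<and>
       \<phi> = (\<lambda>(x, y). (\<tau> x, \<tau> y * b)))"
proof
  have ext: "field_extension emb"
    using assms(1) by (simp add: separable_extension_def)
  show "\<exists>\<tau> b. \<tau> \<in> Aut_ext emb \<and> \<tau> \<circ> \<sigma> = \<sigma> \<circ> \<tau> \<and> b \<noteq> 0 \<and>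
       \<eta> * b * \<sigma> b = \<tau> \<eta> \<and> \<mu> * \<sigma> b = \<tau> \<mu> \<and> \<phi> = (\<lambda>(x, y). (\<tau> x, \<tau> y * b))"
    if "\<phi> \<in> HK_Aut emb \<sigma> \<eta> \<mu>"
    by (rule HK_Aut_necessary[OF assms(2,3,5) that]) (intro exI conjI)
  show "\<phi> \<in> HK_Aut emb \<sigma> \<eta> \<mu>"
    if "\<exists>\<tau> b. \<tau> \<in> Aut_ext emb \<and> \<tau> \<circ> \<sigma> = \<sigma> \<circ> \<tau> \<and> b \<noteq> 0 \<and>
       \<eta> * b * \<sigma> b = \<tau> \<eta> \<and> \<mu> * \<sigma> b = \<tau> \<mu> \<and> \<phi> = (\<lambda>(x, y). (\<tau> x, \<tau> y * b))"
    using that by (elim exE conjE, hypsubst) (rule HK_Aut_sufficient[OF ext _ _ assms(2)])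
qed

end
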